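(* Let $a<b$ be real numbers, let $\Omega=(a,b)$, let $2<p<\infty$, and let $u_p(x)=\sin_p\!\left(\pi_p\frac{x-a}{b-a}\right)$, $x\in[a,b]$, be the first Dirichlet eigenfunction of the $p$-Laplacian on $(a,b)$ normalized by $\|u_p\|_\infty=1$. Let $x_0=\frac{a+b}{2}$ be the point where $u_p$ attains its maximum, and set $$K_p:=\frac{(p-1)^{p/(p-1)}}{p}\left(\frac{\pi_p}{b-a}\right)^{p/(p-1)}>0.$$ Then, near $x_0$, the leading behavior of $u_p$ is $u_p(x)\sim 1-K_p|x-x_0|^{p/(p-1)}$, that is, $$\lim_{x\to x_0}\frac{1-u_p(x)}{|x-x_0|^{p/(p-1)}}=K_p.$$ Consequently, $u_p\in C^{1,1/(p-1)}(\overline{\Omega})$; in particular $u_p'$ is Hölder continuous at $x_0$ with exponent $1/(p-1)$. Moreover, $u_p$ is not in $C^2$.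
   Context: For $1<p<\infty$ define $F_p:[0,1]\to\mathbb{R}$ by $F_p(x)=\int_0^x (1-t^p)^{-1/p}\,dt$. It is strictly increasing with range $[0,\pi_p/2]$, where $\frac{\pi_p}{2}:=F_p(1)=\frac{\pi}{p\sin(\pi/p)}$. The generalized sine function is $\sin_p(x):=F_p^{-1}(x)$ for $x\in[0,\pi_p/2]$, extended to $[0,\pi_p]$ by symmetry, $\sin_p(x)=\sin_p(\pi_p-x)$ for $x\in[\pi_p/2,\pi_p]$. The function $u_p$ in the claim is the (known) first eigenfunction of the problem $-(|u'|^{p-2}u')'=\lambda |u|^{p-2}u$ on $(a,b)$, $u(a)=u(b)=0$, $\|u\|_\infty=1$, with first eigenvalue $\lambda_p=(p-1)\left(\frac{\pi_p}{b-a}\right)^p$; for the purposes of the claim $u_p$ is given by the explicit formula. $C^{1,\sigma}(\overline{\Omega})$ with $0<\sigma\le 1$ denotes the functions that are continuously differentiable on $\overline{\Omega}=[a,b]$ with $\sigma$-Hölder continuous derivative on $[a,b]$. *)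

theory Defs
  imports "HOL-Analysis.Analysis"
begin

text \<open>The function \<open>F\<^sub>p\<close>. The integrand is singular at \<open>t = 1\<close>, where the
  convention \<open>0 powr _ = 0\<close> applies; a single point does not affect the integral. All definitions
  are meant for \<open>1 < p\<close>.\<close>

definition gen_arcsin :: "real \<Rightarrow> real \<Rightarrow> real" where
  "gen_arcsin p x = integral {0..x} (\<lambda>t. (1 - t powr p) powr (- 1 / p))"

definition gen_pi :: "real \<Rightarrow> real" where
  "gen_pi p = 2 * gen_arcsin p 1"

text \<open>Only the values on \<open>[0, \<pi>\<^sub>p]\<close> are meaningful.\<close>

definition gen_sin :: "real \<Rightarrow> real \<Rightarrow> real" where
  "gen_sin p x =
     (if x \<le> gen_pi p / 2 then the_inv_into {0..1} (gen_arcsin p) x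
      else the_inv_into {0..1} (gen_arcsin p) (gen_pi p - x))"

definition eigenfun :: "real \<Rightarrow> real \<Rightarrow> real \<Rightarrow> real \<Rightarrow> real" where
  "eigenfun p a b x = gen_sin p (gen_pi p * ((x - a) / (b - a)))"

definition K_const :: "real \<Rightarrow> real \<Rightarrow> real \<Rightarrow> real" where
  "K_const p a b =
     (p - 1) powr (p / (p - 1)) / p * (gen_pi p / (b - a)) powr (p / (p - 1))"

definition holder_on :: "real \<Rightarrow> real set \<Rightarrow> (real \<Rightarrow> real) \<Rightarrow> bool" where
  "holder_on \<sigma> S g \<longleftrightarrow> (\<exists>C. \<forall>x\<in>S. \<forall>y\<in>S. \<bar>g x - g y\<bar> \<le> C * \<bar>x - y\<bar> powr \<sigma>)"

definition holder_at :: "real \<Rightarrow> real \<Rightarrow> (real \<Rightarrow> real) \<Rightarrow> bool" where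
  "holder_at \<sigma> x\<^sub>0 g \<longleftrightarrow> (\<exists>C. \<forall>\<^sub>F x in nhds x\<^sub>0. \<bar>g x - g x\<^sub>0\<bar> \<le> C * \<bar>x - x\<^sub>0\<bar> powr \<sigma>)"

text \<open>Derivatives are taken within \<open>S\<close>, hence are one-sided at the endpoints of a closed interval;
  values of \<open>f\<close> outside \<open>S\<close> play no role.\<close>

definition C1_holder_on :: "real \<Rightarrow> real set \<Rightarrow> (real \<Rightarrow> real) \<Rightarrow> bool" where
  "C1_holder_on \<sigma> S f \<longleftrightarrow>
     (\<exists>f'. (\<forall>x\<in>S. (f has_real_derivative f' x) (at x within S)) \<and>
           continuous_on S f' \<and> holder_on \<sigma> S f')"

definition C2_on :: "real set \<Rightarrow> (real \<Rightarrow> real) \<Rightarrow> bool" where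
  "C2_on S f \<longleftrightarrow>
     (\<exists>f' f''. (\<forall>x\<in>S. (f has_real_derivative f' x) (at x within S)) \<and>
               (\<forall>x\<in>S. (f' has_real_derivative f'' x) (at x within S)) \<and>
               continuous_on S f'')"

end

theory Submission
  imports Defs
begin

text \<open>
  The eigenfunction is symmetric about the midpoint \<open>m = (a + b) / 2\<close>, so it is described by one
  function of the distance to \<open>m\<close>: with \<open>c = \<pi>\<^sub>p / (b - a)\<close>,
  \<open>u(x) = T(c \<bar>x - m\<bar>)\<close>, where \<open>T(y) = sin\<^sub>p(\<pi>\<^sub>p/2 - y)\<close> is the \<open>profile\<close>. Inverting the
  defining integral gives \<open>T' = - (1 - T\<^sup>p)\<close> to the power \<open>1/p\<close>.

  Everything rests on the quantity \<open>flux = \<bar>T'\<bar>\<close> to the power \<open>p - 1\<close>. The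
  \<open>p\<close>-Laplace equation says that its derivative is \<open>p - 1\<close> times \<open>T\<close> to the power \<open>p - 1\<close>
  (\<open>flux_has_derivative\<close>), which is bounded by \<open>p - 1\<close> and tends to
  \<open>p - 1\<close> at the maximum. Two facts follow: the flux is Lipschitz (\<open>flux_Lipschitz\<close>), and
  \<open>flux y / y\<close> tends to \<open>p - 1\<close> as \<open>y\<close> tends to \<open>0\<close> from above
  (\<open>flux_over_distance_tendsto\<close>).

  The claims are read off from these two facts. Since \<open>1 - T\<^sup>p\<close> is the flux to the power
  \<open>p / (p - 1)\<close>, and \<open>(1 - s\<^sup>p) / (1 - s)\<close> tends to \<open>p\<close> as \<open>s\<close> tends to \<open>1\<close>, the ratio of
  \<open>1 - T(y)\<close> to the power \<open>p / (p - 1)\<close> of \<open>y\<close> converges, to \<open>1 / p\<close> times the power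
  \<open>p / (p - 1)\<close> of \<open>p - 1\<close>; rescaling by \<open>c\<close> gives the constant \<open>K\<^sub>p\<close>. Because
  \<open>\<bar>T'\<bar>\<close> is the power \<open>1 / (p - 1)\<close> of a Lipschitz function and that exponent is at most \<open>1\<close>, it is
  Hoelder continuous with this exponent; the odd reflection at \<open>m\<close>, where \<open>T'\<close> vanishes, only
  doubles the constant. Finally, if \<open>u''(m)\<close> existed, then \<open>T'(y) / y\<close> would stay bounded near
  \<open>0\<close>, and \<open>flux y / y\<close>, being \<open>\<bar>T'(y)\<bar> / y\<close> times the power \<open>p - 2 > 0\<close> of the vanishing
  quantity \<open>\<bar>T'(y)\<bar>\<close>, would tend to \<open>0\<close> instead of \<open>p - 1\<close>.
\<close>

section \<open>The integral defining the inverse of the generalized sine\<close>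

text \<open>On \<open>[0, 1]\<close> one has \<open>t\<^sup>p \<le> t\<close>, so the singularity at \<open>1\<close> is no worse than that of
  \<open>1 - t\<close> to the power \<open>- 1 / p\<close>, which is integrable because \<open>1 / p < 1\<close>.\<close>
lemma gen_arcsin_integrand_integrable:
  fixes p :: real
  assumes "1 < p"
  shows "(\<lambda>t. (1 - t powr p) powr (- 1 / p)) integrable_on {0..1}"
proof (rule measurable_bounded_by_integrable_imp_integrable)
  have "(\<lambda>t::real. (1 - t powr p) powr (- 1 / p)) \<in> borel_measurable borel"
    by measurable
  then show "(\<lambda>t::real. (1 - t powr p) powr (- 1 / p)) \<in> borel_measurable (lebesgue_on {0..1})"
    by (intro measurable_restrict_space1 measurable_completion) simp
  have "(\<lambda>x. x powr (- 1 / p)) integrable_on {0..1}"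
    by (rule integrable_on_powr_from_0) (use assms in \<open>auto simp: field_simps\<close>)
  then have "((\<lambda>x. (x::real) powr (- 1 / p)) has_integral integral {0..1} (\<lambda>x. x powr (- 1 / p))) (cbox 0 1)"
    by (simp add: has_integral_integral)
  \<comment> \<open>Reflecting by \<open>t \<mapsto> 1 - t\<close> moves the singularity from \<open>0\<close> to \<open>1\<close>.\<close>
  from has_integral_affinity[OF this, of "-1" 1]
  show "(\<lambda>t::real. (1 - t) powr (- 1 / p)) integrable_on {0..1}"
    by (auto simp: integrable_on_def)
  show "norm ((1 - t powr p) powr (- 1 / p)) \<le> (1 - t) powr (- 1 / p)" if "t \<in> {0..1}" for t :: real
  proof (cases "t = 1")
    case False
    have "t powr p \<le> t powr 1"
      by (rule powr_mono') (use assms that in auto)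
    then show ?thesis
      using that False assms by (auto intro!: powr_mono2')
  qed auto
qed auto

lemma continuous_on_gen_arcsin:
  assumes "1 < p"
  shows "continuous_on {0..1} (gen_arcsin p)"
  unfolding gen_arcsin_def
  by (rule indefinite_integral_continuous_1[OF gen_arcsin_integrand_integrable[OF assms]])

lemma gen_arcsin_has_derivative:
  fixes p s :: real
  assumes "1 < p" "0 \<le> s" "s < 1"
  shows "(gen_arcsin p has_real_derivative (1 - s powr p) powr (- 1 / p)) (at s within {0..1})"
proof -
  \<comment> \<open>The integrand is continuous only away from \<open>1\<close>, so the fundamental theorem is applied on
    an interval that ends strictly between \<open>s\<close> and \<open>1\<close>.\<close>
  define c where "c = (s + 1) / 2"
  have c: "s < c" "c < 1" using assms by (auto simp: c_def)
  have "t powr p < 1" if "t \<in> {0..c}" for t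
    using that c assms powr_less_mono2[of p t 1] by auto
  then have "continuous_on {0..c} (\<lambda>t. (1 - t powr p) powr (- 1 / p))"
    using assms by (intro continuous_on_powr continuous_on_diff continuous_on_const
        continuous_on_powr' continuous_on_id) force+
  from integral_has_real_derivative[OF this, of s]
  have "(gen_arcsin p has_real_derivative (1 - s powr p) powr (- 1 / p)) (at s within {0..c})"
    using assms c unfolding gen_arcsin_def by simp
  moreover have "at s within {0..c} = at s within {0..1}"
    by (rule at_within_nhd[of _ "{..<c}"]) (use assms c in auto)
  ultimately show ?thesis by simp
qed

lemma gen_arcsin_strict_mono:
  assumes "1 < p" "0 \<le> s" "s < t" "t \<le> 1"
  shows "gen_arcsin p s < gen_arcsin p t"
proof (rule DERIV_pos_imp_increasing_open[OF assms(3)])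
  show "continuous_on {s..t} (gen_arcsin p)"
    by (rule continuous_on_subset[OF continuous_on_gen_arcsin]) (use assms in auto)
  fix x assume x: "s < x" "x < t"
  have "at x within {0..1} = at x"
    by (rule at_within_interior) (use x assms in auto)
  moreover have "x powr p < 1"
    using x assms powr_less_mono2[of p x 1] by auto
  ultimately show "\<exists>y. DERIV (gen_arcsin p) x :> y \<and> y > 0"
    using gen_arcsin_has_derivative[of p x] x assms by (intro exI[of _ "(1 - x powr p) powr (- 1 / p)"]) auto
qed

lemma inj_on_gen_arcsin:
  assumes "1 < p"
  shows "inj_on (gen_arcsin p) {0..1}"
  by (rule linorder_inj_onI) (use gen_arcsin_strict_mono[OF assms] in fastforce)+

lemma gen_arcsin_0 [simp]: "gen_arcsin p 0 = 0"
  by (simp add: gen_arcsin_def)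

lemma gen_pi_pos:
  assumes "1 < p"
  shows "0 < gen_pi p"
  using gen_arcsin_strict_mono[OF assms, of 0 1] by (simp add: gen_pi_def)

lemma gen_arcsin_image:
  assumes "1 < p"
  shows "gen_arcsin p ` {0..1} = {0..gen_pi p / 2}"
proof -
  have "gen_arcsin p s \<in> {0..gen_pi p / 2}" if "s \<in> {0..1}" for s
    using that gen_arcsin_strict_mono[OF assms, of 0 s] gen_arcsin_strict_mono[OF assms, of s 1]
    by (cases "s = 0"; cases "s = 1") (auto simp: gen_pi_def)
  moreover have "y \<in> gen_arcsin p ` {0..1}" if "y \<in> {0..gen_pi p / 2}" for y
    using IVT'[of "gen_arcsin p" 0 y 1] that continuous_on_gen_arcsin[OF assms]
    by (auto simp: gen_pi_def)
  ultimately show ?thesis by blast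
qed

section \<open>The eigenfunction as a function of the distance to its maximum\<close>

text \<open>This is \<open>sin\<^sub>p(\<pi>\<^sub>p/2 - y)\<close>, the analogue of the cosine on its first quarter period. Measuring
  from the maximum places the critical point at \<open>y = 0\<close> and makes both halves of the eigenfunction
  instances of the same function.\<close>
definition profile :: "real \<Rightarrow> real \<Rightarrow> real" where
  "profile p y = the_inv_into {0..1} (gen_arcsin p) (gen_pi p / 2 - y)"

lemma profile_gen_arcsin:
  assumes "1 < p" "s \<in> {0..1}"
  shows "profile p (gen_pi p / 2 - gen_arcsin p s) = s"
  using assms by (simp add: profile_def the_inv_into_f_f[OF inj_on_gen_arcsin])

lemma gen_arcsin_profile:
  assumes "1 < p" "y \<in> {0..gen_pi p / 2}"
  shows "profile p y \<in> {0..1}" "gen_arcsin p (profile p y) = gen_pi p / 2 - y"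
proof -
  have "gen_pi p / 2 - y \<in> gen_arcsin p ` {0..1}"
    using assms by (auto simp: gen_arcsin_image)
  then show "profile p y \<in> {0..1}" "gen_arcsin p (profile p y) = gen_pi p / 2 - y"
    unfolding profile_def using inj_on_gen_arcsin[OF assms(1)]
    by (auto intro!: f_the_inv_into_f dest: the_inv_into_into[OF _ _ order_refl])
qed

text \<open>The profile inverts the map \<open>s \<mapsto> \<pi>\<^sub>p/2 - F\<^sub>p(s)\<close>; knowing the image of this map turns
  statements about inverse functions into statements on the interval \<open>[0, \<pi>\<^sub>p/2]\<close>.\<close>
lemma image_gap_gen_arcsin:
  assumes "1 < p"
  shows "(\<lambda>s. gen_pi p / 2 - gen_arcsin p s) ` {0..1} = {0..gen_pi p / 2}"
proof -
  have "(\<lambda>s. gen_pi p / 2 - gen_arcsin p s) ` {0..1} = (\<lambda>y. gen_pi p / 2 - y) ` gen_arcsin p ` {0..1}"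
    by (simp add: image_image)
  also have "\<dots> = {0..gen_pi p / 2}"
    using gen_pi_pos[OF assms] by (simp add: gen_arcsin_image[OF assms])
  finally show ?thesis .
qed

lemma continuous_on_profile:
  assumes "1 < p"
  shows "continuous_on {0..gen_pi p / 2} (profile p)"
proof -
  have "continuous_on ((\<lambda>s. gen_pi p / 2 - gen_arcsin p s) ` {0..1}) (profile p)"
    by (rule continuous_on_inv)
       (use assms in \<open>auto intro!: continuous_intros continuous_on_gen_arcsin profile_gen_arcsin\<close>)
  then show ?thesis by (simp add: image_gap_gen_arcsin assms)
qed

lemma profile_0 [simp]:
  assumes "1 < p"
  shows "profile p 0 = 1"
  using profile_gen_arcsin[OF assms, of 1] by (simp add: gen_pi_def)

lemma profile_less_1:
  assumes "1 < p" "0 < y" "y \<le> gen_pi p / 2"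
  shows "profile p y < 1"
proof -
  have "profile p y \<noteq> 1"
    using gen_arcsin_profile(2)[of p y] assms by (auto simp: gen_pi_def)
  then show ?thesis using gen_arcsin_profile(1)[of p y] assms by auto
qed

lemma profile_pos:
  assumes "1 < p" "0 \<le> y" "y < gen_pi p / 2"
  shows "0 < profile p y"
proof -
  have "profile p y \<noteq> 0"
    using gen_arcsin_profile(2)[of p y] assms by (auto simp: gen_pi_def)
  then show ?thesis using gen_arcsin_profile(1)[of p y] assms by auto
qed

section \<open>The flux\<close>

text \<open>The quantity \<open>\<bar>u'\<bar>\<close> to the power \<open>p - 1\<close> for \<open>u = profile p\<close>, written in terms of
  \<open>u\<close> itself. It is the flux whose divergence is the \<open>p\<close>-Laplacian, and it stays differentiable
  up to the maximum, where \<open>u'\<close> does not when \<open>p > 2\<close>.\<close>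
definition flux :: "real \<Rightarrow> real \<Rightarrow> real" where
  "flux p y = (1 - profile p y powr p) powr ((p - 1) / p)"

lemma profile_powr_le_1:
  assumes "1 < p" "y \<in> {0..gen_pi p / 2}"
  shows "profile p y powr p \<le> 1"
  using gen_arcsin_profile(1)[OF assms] assms by (auto intro!: powr_le1)

lemma flux_root:
  assumes "1 < p"
  shows "flux p y powr (1 / (p - 1)) = (1 - profile p y powr p) powr (1 / p)"
  using assms by (simp add: flux_def powr_powr)

text \<open>At \<open>y = 0\<close> the derivative of the inverted map is infinite, so the inverse function theorem
  gives nothing there and that point is excluded. At the other end \<open>y = \<pi>\<^sub>p/2\<close> the
  derivative is one-sided; this yields the boundary derivatives of the eigenfunction.\<close>
lemma profile_has_derivative:
  assumes "1 < p" "0 < y" "y \<le> gen_pi p / 2"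
  shows "(profile p has_real_derivative - (flux p y powr (1 / (p - 1)))) (at y within {0..gen_pi p / 2})"
proof -
  let ?s = "profile p y" and ?G = "\<lambda>s. gen_pi p / 2 - gen_arcsin p s"
  let ?d = "(1 - ?s powr p) powr (- 1 / p)"
  have y: "y \<in> {0..gen_pi p / 2}" using assms by auto
  have s: "?s \<in> {0..1}" "?s < 1" "?G ?s = y"
    using gen_arcsin_profile[OF assms(1) y] profile_less_1[OF assms] by auto
  then have "?s powr p < 1" using assms powr_less_mono2[of p ?s 1] by auto
  then have d: "?d > 0" "- (flux p y powr (1 / (p - 1))) = - inverse ?d"
    using assms by (auto simp: flux_root powr_minus[symmetric])
  have "(?G has_real_derivative - ?d) (at ?s within {0..1})"
    using s assms by (auto intro!: derivative_eq_intros gen_arcsin_has_derivative)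
  then have "(?G has_derivative (\<lambda>h. - ?d * h)) (at ?s within {0..1})"
    unfolding has_field_derivative_def .
  moreover have "continuous (at (?G ?s) within ?G ` {0..1}) (profile p)"
    using continuous_on_profile[OF assms(1)] s(3) y image_gap_gen_arcsin[OF assms(1)]
    by (simp add: continuous_on_eq_continuous_within)
  moreover have "linear (\<lambda>h. - inverse ?d * h)"
    by (rule linear_times)
  moreover have "(\<lambda>h. - inverse ?d * h) \<circ> (\<lambda>h. - ?d * h) = id"
    using d by (auto simp: fun_eq_iff)
  ultimately have "(profile p has_derivative (\<lambda>h. - inverse ?d * h)) (at (?G ?s) within ?G ` {0..1})"
    using s(1) assms by (intro has_derivative_inverse_within) (auto intro: profile_gen_arcsin)
  then show ?thesis
    unfolding has_field_derivative_def d(2) s(3) image_gap_gen_arcsin[OF assms(1)] .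
qed

text \<open>The first integral \<open>\<bar>T'\<bar>\<^sup>p + T\<^sup>p = 1\<close> differentiated: the singular power of \<open>1 - T\<^sup>p\<close> that
  arises from the outer function is cancelled exactly by \<open>T'\<close>. This is the eigenvalue
  equation of the \<open>p\<close>-Laplacian.\<close>
lemma flux_has_derivative:
  assumes "1 < p" "0 < y" "y < gen_pi p / 2"
  shows "(flux p has_real_derivative (p - 1) * profile p y powr (p - 1)) (at y)"
proof -
  let ?s = "profile p y"
  have s: "0 < ?s" "?s < 1" using profile_pos profile_less_1 assms by auto
  then have pos: "0 < 1 - ?s powr p" using assms powr_less_mono2[of p ?s 1] by auto
  have "at y within {0..gen_pi p / 2} = at y"
    by (rule at_within_interior) (use assms in auto)
  then have "(profile p has_real_derivative - ((1 - ?s powr p) powr (1 / p))) (at y)"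
    using profile_has_derivative[of p y] assms by (simp add: flux_root)
  then have "(flux p has_real_derivative
      (p - 1) / p * (1 - ?s powr p) powr ((p - 1) / p - 1) *
      (p * ?s powr (p - 1) * (1 - ?s powr p) powr (1 / p))) (at y)"
    unfolding flux_def[abs_def] using s pos
    by (auto intro!: derivative_eq_intros)
  moreover have "(1 - ?s powr p) powr ((p - 1) / p - 1) * (1 - ?s powr p) powr (1 / p) = 1"
    using assms pos by (simp add: powr_add[symmetric] field_simps)
  ultimately show ?thesis using assms by (simp add: ac_simps)
qed

lemma continuous_on_flux:
  assumes "1 < p"
  shows "continuous_on {0..gen_pi p / 2} (flux p)"
  unfolding flux_def[abs_def]
  using assms gen_arcsin_profile(1)[OF assms] profile_powr_le_1[OF assms]
  by (intro continuous_on_powr' continuous_intros continuous_on_profile) auto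

lemma flux_0 [simp]: "1 < p \<Longrightarrow> flux p 0 = 0"
  by (simp add: flux_def)

text \<open>The source of all regularity: the derivative of the flux is bounded by \<open>p - 1\<close> because
  \<open>0 \<le> T \<le> 1\<close>.\<close>
lemma flux_Lipschitz:
  assumes "1 < p" "x \<in> {0..gen_pi p / 2}" "y \<in> {0..gen_pi p / 2}"
  shows "\<bar>flux p x - flux p y\<bar> \<le> (p - 1) * \<bar>x - y\<bar>"
  using assms(2,3)
proof (induction x y rule: linorder_wlog)
  case (le x y)
  show ?case
  proof (cases "x = y")
    case False
    with le have xy: "x < y" by auto
    have "continuous_on {x..y} (flux p)"
      by (rule continuous_on_subset[OF continuous_on_flux[OF assms(1)]]) (use le in auto)
    moreover have der: "(flux p has_real_derivative (p - 1) * profile p z powr (p - 1)) (at z)"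
      if "x < z" "z < y" for z
      using flux_has_derivative[OF assms(1), of z] that le by auto
    ultimately obtain l z where z: "x < z" "z < y" "DERIV (flux p) z :> l"
      "flux p y - flux p x = (y - x) * l"
      using MVT[OF xy, of "flux p"] real_differentiable_def by blast
    then have "l = (p - 1) * profile p z powr (p - 1)"
      using der DERIV_unique by blast
    moreover have "profile p z \<in> {0..1}"
      using gen_arcsin_profile(1)[OF assms(1), of z] z le by auto
    then have "profile p z powr (p - 1) \<in> {0..1}"
      using assms by (auto intro!: powr_le1)
    ultimately have "\<bar>l\<bar> \<le> p - 1"
      using assms by (auto simp: abs_mult intro!: mult_left_le)
    then show ?thesis
      using xy by (simp add: abs_minus_commute[of "flux p x"] z(4) abs_mult mult.commute)
  qed simp
qed (simp add: abs_minus_commute)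

section \<open>Asymptotics at the maximum\<close>
lemma eventually_at_right_0_less_gen_pi:
  assumes "1 < p"
  shows "\<forall>\<^sub>F y in at_right 0. 0 < y \<and> y < gen_pi p / 2"
  using gen_pi_pos[OF assms] by (auto simp: eventually_at_right intro!: exI[of _ "gen_pi p / 2"])

lemma at_0_within_gen_pi:
  assumes "1 < p"
  shows "at 0 within {0..gen_pi p / 2} = at_right 0"
  using gen_pi_pos[OF assms] by (simp add: at_within_Icc_at_right)

lemma profile_tendsto:
  assumes "1 < p"
  shows "(profile p \<longlongrightarrow> 1) (at_right 0)"
proof -
  have "(profile p \<longlongrightarrow> profile p 0) (at 0 within {0..gen_pi p / 2})"
    using continuous_on_profile[OF assms] gen_pi_pos[OF assms]
    unfolding continuous_on_def by auto
  then show ?thesis by (simp add: at_0_within_gen_pi assms)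
qed

lemma flux_tendsto:
  assumes "1 < p"
  shows "(flux p \<longlongrightarrow> 0) (at_right 0)"
proof -
  have "(flux p \<longlongrightarrow> flux p 0) (at 0 within {0..gen_pi p / 2})"
    using continuous_on_flux[OF assms] gen_pi_pos[OF assms]
    unfolding continuous_on_def by auto
  then show ?thesis by (simp add: at_0_within_gen_pi assms)
qed

lemma flux_over_distance_tendsto:
  assumes "1 < p"
  shows "((\<lambda>y. flux p y / y) \<longlongrightarrow> p - 1) (at_right 0)"
proof (rule lhopital_right_0[where g' = "\<lambda>_. 1" and f' = "\<lambda>y. (p - 1) * profile p y powr (p - 1)"])
  show "\<forall>\<^sub>F y in at_right 0. DERIV (flux p) y :> (p - 1) * profile p y powr (p - 1)"
    using eventually_at_right_0_less_gen_pi[OF assms]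
    by eventually_elim (use flux_has_derivative assms in auto)
  have "((\<lambda>y. (p - 1) * profile p y powr (p - 1) / 1) \<longlongrightarrow> (p - 1) * 1 powr (p - 1) / 1) (at_right 0)"
    by (intro tendsto_intros profile_tendsto assms) auto
  then show "((\<lambda>y. (p - 1) * profile p y powr (p - 1) / 1) \<longlongrightarrow> p - 1) (at_right 0)"
    by simp
  show "\<forall>\<^sub>F y::real in at_right 0. y \<noteq> 0"
    by (auto simp: eventually_at_right_field intro: exI[of _ 1])
qed (auto intro: flux_tendsto assms)

text \<open>The expansion of the profile at its maximum. The power \<open>p / (p - 1)\<close> of the flux is
  \<open>1 - T\<^sup>p\<close>, which differs from \<open>1 - T\<close> by a factor that converges to the derivative \<open>p\<close> of
  \<open>s \<mapsto> s\<^sup>p\<close> at \<open>1\<close>.\<close>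
lemma profile_deficit_tendsto:
  assumes "1 < p"
  shows "((\<lambda>y. (1 - profile p y) / y powr (p / (p - 1))) \<longlongrightarrow> (p - 1) powr (p / (p - 1)) / p) (at_right 0)"
proof -
  have "((\<lambda>s. s powr p) has_real_derivative p * 1 powr (p - 1)) (at 1)"
    by (rule has_real_derivative_powr) simp
  then have "((\<lambda>s. (s powr p - 1) / (s - 1)) \<longlongrightarrow> p) (at 1)"
    by (simp add: has_field_derivative_iff)
  moreover have "(s powr p - 1) / (s - 1) = (1 - s powr p) / (1 - s)" for s
    by (metis minus_diff_eq minus_divide_divide)
  ultimately have lim1: "((\<lambda>s. (1 - s powr p) / (1 - s)) \<longlongrightarrow> p) (at 1)"
    by simp
  have "filterlim (profile p) (at 1) (at_right 0)"
    unfolding filterlim_at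
    using eventually_at_right_0_less_gen_pi[OF assms] profile_tendsto[OF assms]
    by (auto elim!: eventually_mono dest!: profile_less_1[OF assms])
  from filterlim_compose[OF lim1 this]
  have "((\<lambda>y. (flux p y / y) powr (p / (p - 1)) / ((1 - profile p y powr p) / (1 - profile p y)))
     \<longlongrightarrow> (p - 1) powr (p / (p - 1)) / p) (at_right 0)"
    using assms by (intro tendsto_divide tendsto_powr flux_over_distance_tendsto tendsto_const) auto
  then show ?thesis
  proof (rule Lim_transform_eventually)
    show "\<forall>\<^sub>F y in at_right 0. (flux p y / y) powr (p / (p - 1)) / ((1 - profile p y powr p) / (1 - profile p y))
        = (1 - profile p y) / y powr (p / (p - 1))"
      using eventually_at_right_0_less_gen_pi[OF assms]
    proof eventually_elim
      case (elim y)
      let ?s = "profile p y"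
      have s: "0 < ?s" "?s < 1" using profile_pos profile_less_1 assms elim by auto
      then have pos: "0 < 1 - ?s powr p" using assms powr_less_mono2[of p ?s 1] by auto
      have "flux p y powr (p / (p - 1)) = 1 - ?s powr p"
        using assms pos by (simp add: flux_def powr_powr)
      moreover have "(flux p y / y) powr (p / (p - 1)) = flux p y powr (p / (p - 1)) / y powr (p / (p - 1))"
        by (rule powr_divide)
      ultimately show ?case using s pos elim assms by simp
    qed
  qed
qed

text \<open>Since the exponent \<open>p / (p - 1)\<close> exceeds \<open>1\<close>, the expansion already shows that the
  eigenfunction has derivative \<open>0\<close> at its maximum, the one point that the inverse function
  theorem misses.\<close>
lemma profile_deficit_over_distance_tendsto_0:
  assumes "1 < p"
  shows "((\<lambda>y. (1 - profile p y) / y) \<longlongrightarrow> 0) (at_right 0)"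
proof -
  have "((\<lambda>y::real. y powr (1 / (p - 1))) \<longlongrightarrow> 0) (at_right 0)"
    by (rule tendsto_zero_powrI[where b = "1 / (p - 1)"])
       (use assms in \<open>auto intro: tendsto_eq_intros simp: eventually_at_right_field intro: exI[of _ 1]\<close>)
  from tendsto_mult[OF profile_deficit_tendsto[OF assms] this]
  have "((\<lambda>y. (1 - profile p y) / y powr (p / (p - 1)) * y powr (1 / (p - 1))) \<longlongrightarrow> 0) (at_right 0)"
    by simp
  then show ?thesis
  proof (rule Lim_transform_eventually)
    show "\<forall>\<^sub>F y in at_right 0. (1 - profile p y) / y powr (p / (p - 1)) * y powr (1 / (p - 1)) = (1 - profile p y) / y"
      using eventually_at_right_0_less_gen_pi[OF assms]
    proof eventually_elim
      case (elim y)
      have "p / (p - 1) = 1 + 1 / (p - 1)"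
        using assms by (simp add: field_simps)
      then have "y powr (p / (p - 1)) = y * y powr (1 / (p - 1))"
        using elim by (simp add: powr_add)
      then show ?case using elim by simp
    qed
  qed
qed

section \<open>Two facts about real functions\<close>

text \<open>Subadditivity of concave powers: for \<open>0 \<le> t \<le> 1\<close> both \<open>t\<close> and \<open>1 - t\<close> are at most their
  own \<open>r\<close>-th powers, so the two powers add up to at least \<open>1\<close>.\<close>
lemma powr_diff_le:
  fixes a b r :: real
  assumes "0 \<le> a" "0 \<le> b" "0 < r" "r \<le> 1"
  shows "\<bar>a powr r - b powr r\<bar> \<le> \<bar>a - b\<bar> powr r"
  using assms(1,2)
proof (induction a b rule: linorder_wlog)
  case (le a b)
  show ?case
  proof (cases "b = 0")
    case False
    with le have b: "0 < b" by auto
    define t where "t = a / b"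
    have t: "t \<in> {0..1}" "a = t * b" "b - a = (1 - t) * b"
      using le b by (auto simp: t_def field_simps)
    have "t powr 1 \<le> t powr r" "(1 - t) powr 1 \<le> (1 - t) powr r"
      using powr_mono'[of r 1 t] powr_mono'[of r 1 "1 - t"] t(1) assms by auto
    then have "1 \<le> t powr r + (1 - t) powr r"
      using t by auto
    then have "b powr r \<le> (t powr r + (1 - t) powr r) * b powr r"
      by (metis mult_1 mult_right_mono powr_ge_zero)
    also have "\<dots> = a powr r + (b - a) powr r"
      unfolding t(2) t(3)[unfolded t(2)] using t b by (simp add: powr_mult distrib_right)
    finally have "b powr r - a powr r \<le> (b - a) powr r" by simp
    moreover have "a powr r \<le> b powr r"
      using le assms by (intro powr_mono2) auto
    ultimately show ?thesis using le by (simp add: abs_if)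
  qed (use le in auto)
qed (simp add: abs_minus_commute)

lemma DERIV_abs_diff:
  fixes m x :: real
  assumes "x \<noteq> m"
  shows "((\<lambda>x. \<bar>x - m\<bar>) has_real_derivative sgn (x - m)) (at x)"
proof (cases "x > m")
  case True
  have "((\<lambda>x. x - m) has_real_derivative 1) (at x)"
    by (auto intro!: derivative_eq_intros)
  then have "((\<lambda>x. \<bar>x - m\<bar>) has_real_derivative 1) (at x)"
    by (rule has_field_derivative_transform_within_open[of _ _ _ "{m<..}"]) (use True in auto)
  then show ?thesis using True by simp
next
  case False
  have "((\<lambda>x. m - x) has_real_derivative -1) (at x)"
    by (auto intro!: derivative_eq_intros)
  then have "((\<lambda>x. \<bar>x - m\<bar>) has_real_derivative -1) (at x)"
    by (rule has_field_derivative_transform_within_open[of _ _ _ "{..<m}"]) (use False assms in auto)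
  then show ?thesis using False assms by simp
qed

section \<open>Transfer to the interval\<close>
definition scaled_distance :: "real \<Rightarrow> real \<Rightarrow> real \<Rightarrow> real \<Rightarrow> real" where
  "scaled_distance p a b x = gen_pi p / (b - a) * \<bar>x - (a + b) / 2\<bar>"

lemma eigenfun_eq_profile:
  assumes "a < b"
    and "1 < p"
  shows "eigenfun p a b x = profile p (scaled_distance p a b x)"
proof -
  define z where "z = gen_pi p / (b - a) * (x - (a + b) / 2)"
  have dist: "scaled_distance p a b x = \<bar>z\<bar>"
    using assms gen_pi_pos[of p] by (simp add: scaled_distance_def z_def abs_mult)
  have arg: "gen_pi p * ((x - a) / (b - a)) = gen_pi p / 2 + z"
    using assms by (simp add: z_def field_simps)
  have "gen_pi p - (gen_pi p / 2 + z) = gen_pi p / 2 - z" by simp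
  then show ?thesis
    unfolding eigenfun_def gen_sin_def profile_def dist arg by (cases "z \<le> 0") auto
qed

lemma scaled_distance_bounds:
  assumes "a < b" "1 < p" "x \<in> {a..b}"
  shows "scaled_distance p a b x \<in> {0..gen_pi p / 2}"
proof -
  have "\<bar>x - (a + b) / 2\<bar> \<le> (b - a) / 2"
    using assms(3) by (auto simp: abs_le_iff field_simps)
  then have "gen_pi p / (b - a) * \<bar>x - (a + b) / 2\<bar> \<le> gen_pi p / (b - a) * ((b - a) / 2)"
    using gen_pi_pos[OF assms(2)] assms(1) by (intro mult_left_mono) auto
  also have "\<dots> = gen_pi p / 2" using assms(1) by simp
  finally show ?thesis
    using gen_pi_pos[OF assms(2)] assms(1) by (simp add: scaled_distance_def)
qed

lemma scaled_distance_pos: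
  assumes "a < b" "1 < p" "x \<noteq> (a + b) / 2"
  shows "0 < scaled_distance p a b x"
  using assms gen_pi_pos[OF assms(2)] by (simp add: scaled_distance_def)

lemma scaled_distance_diff_le:
  assumes "a < b" "1 < p"
  shows "\<bar>scaled_distance p a b x - scaled_distance p a b y\<bar> \<le> gen_pi p / (b - a) * \<bar>x - y\<bar>"
proof -
  have "\<bar>\<bar>x - (a + b) / 2\<bar> - \<bar>y - (a + b) / 2\<bar>\<bar> \<le> \<bar>x - y\<bar>" by linarith
  then show ?thesis
    using gen_pi_pos[OF assms(2)] assms(1)
    by (auto simp: scaled_distance_def right_diff_distrib[symmetric] abs_mult intro!: mult_left_mono
        simp del: times_divide_eq_left)
qed

lemma filterlim_scaled_distance:
  assumes "a < b" "1 < p"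
  shows "filterlim (scaled_distance p a b) (at_right 0) (at ((a + b) / 2))"
  unfolding filterlim_at
proof
  have "isCont (scaled_distance p a b) ((a + b) / 2)"
    unfolding scaled_distance_def[abs_def] using assms by (intro continuous_intros) auto
  then show "(scaled_distance p a b \<longlongrightarrow> 0) (at ((a + b) / 2))"
    by (simp add: isCont_def scaled_distance_def)
  show "\<forall>\<^sub>F x in at ((a + b) / 2). scaled_distance p a b x \<in> {0<..} \<and> scaled_distance p a b x \<noteq> 0"
  proof -
    have "\<forall>\<^sub>F x in at ((a + b) / 2). x \<noteq> (a + b) / 2"
      by (simp add: eventually_at_filter)
    then show ?thesis
      by eventually_elim (use scaled_distance_pos[OF assms] in force)
  qed
qed

text \<open>The sign function vanishes at \<open>0\<close>, so the formula gives \<open>0\<close> at the midpoint as well.\<close>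
definition eigenfun_deriv :: "real \<Rightarrow> real \<Rightarrow> real \<Rightarrow> real \<Rightarrow> real" where
  "eigenfun_deriv p a b x =
     - (gen_pi p / (b - a)) * sgn (x - (a + b) / 2) * flux p (scaled_distance p a b x) powr (1 / (p - 1))"

lemma eigenfun_has_derivative:
  assumes "a < b" "1 < p" "x \<in> {a..b}"
  shows "(eigenfun p a b has_real_derivative eigenfun_deriv p a b x) (at x within {a..b})"
proof -
  let ?m = "(a + b) / 2" and ?h = "scaled_distance p a b"
  define c where "c = gen_pi p / (b - a)"
  have u: "eigenfun p a b = (\<lambda>x. profile p (?h x))"
    using eigenfun_eq_profile[OF assms(1,2)] by auto
  have c: "c > 0" using gen_pi_pos assms by (simp add: c_def)
  have h: "?h x = c * \<bar>x - ?m\<bar>" for x by (simp add: scaled_distance_def c_def)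
  show ?thesis
  proof (cases "x = ?m")
    case True
    have eq: "norm ((profile p (?h z) - profile p (?h ?m)) / (z - ?m)) = norm ((1 - profile p (?h z)) / ?h z * c)" for z
      using c assms by (simp add: h abs_mult abs_minus_commute)
    have "((\<lambda>z. (1 - profile p (?h z)) / ?h z * c) \<longlongrightarrow> 0 * c) (at ?m)"
      by (intro tendsto_mult tendsto_const
          filterlim_compose[OF profile_deficit_over_distance_tendsto_0 filterlim_scaled_distance] assms)
    then have "((\<lambda>z. norm ((1 - profile p (?h z)) / ?h z * c)) \<longlongrightarrow> 0) (at ?m)"
      by (intro tendsto_norm_zero) (simp only: mult_zero_left)
    then have "((\<lambda>z. norm ((profile p (?h z) - profile p (?h ?m)) / (z - ?m))) \<longlongrightarrow> 0) (at ?m)"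
      by (simp only: eq)
    then have "((\<lambda>z. (profile p (?h z) - profile p (?h ?m)) / (z - ?m)) \<longlongrightarrow> 0) (at ?m)"
      by (rule tendsto_norm_zero_cancel)
    then have "(eigenfun p a b has_real_derivative 0) (at ?m)"
      unfolding u has_field_derivative_iff .
    then show ?thesis
      using has_field_derivative_at_within by (fastforce simp: True eigenfun_deriv_def)
  next
    case False
    have "(?h has_real_derivative c * sgn (x - ?m)) (at x)"
      unfolding h[abs_def] by (intro DERIV_cmult DERIV_abs_diff False)
    then have "(?h has_real_derivative c * sgn (x - ?m)) (at x within {a..b})"
      by (rule has_field_derivative_at_within)
    moreover have "(profile p has_real_derivative - (flux p (?h x) powr (1 / (p - 1)))) (at (?h x) within ?h ` {a..b})"
    proof (rule DERIV_subset)
      show "(profile p has_real_derivative - (flux p (?h x) powr (1 / (p - 1)))) (at (?h x) within {0..gen_pi p / 2})"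
        using assms scaled_distance_pos[OF assms(1,2) False] scaled_distance_bounds[OF assms]
        by (intro profile_has_derivative) auto
    qed (use scaled_distance_bounds[OF assms(1,2)] in blast)
    ultimately have "(profile p \<circ> ?h has_real_derivative - (flux p (?h x) powr (1 / (p - 1))) * (c * sgn (x - ?m))) (at x within {a..b})"
      by (intro DERIV_image_chain)
    then show ?thesis
      by (simp add: u o_def eigenfun_deriv_def c_def[symmetric] ac_simps)
  qed
qed

text \<open>On each half of the interval the derivative is, up to sign, the power \<open>1 / (p - 1)\<close> of a
  Lipschitz function, hence Hoelder. Points on opposite sides of the midpoint are compared through
  the midpoint, where the derivative vanishes and which is closer to each of them than they are
  to one another.\<close>
lemma eigenfun_deriv_holder:
  assumes "a < b" "2 \<le> p"
  shows "holder_on (1 / (p - 1)) {a..b} (eigenfun_deriv p a b)"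
proof -
  let ?m = "(a + b) / 2" and ?h = "scaled_distance p a b" and ?r = "1 / (p - 1)"
  define c where "c = gen_pi p / (b - a)"
  \<comment> \<open>Up to the factor \<open>c\<close>, this is the modulus of the derivative.\<close>
  define w where "w x = flux p (?h x) powr ?r" for x
  define C where "C = ((p - 1) * c) powr ?r"
  have p: "1 < p" using assms by simp
  have c: "c > 0" using gen_pi_pos[OF p] assms by (simp add: c_def)
  have g: "eigenfun_deriv p a b x = - c * sgn (x - ?m) * w x" for x
    by (simp add: eigenfun_deriv_def c_def w_def)
  have w0: "0 \<le> w x" for x by (simp add: w_def)
  have wm: "w ?m = 0" using p by (simp add: w_def scaled_distance_def)
  have w: "\<bar>w x - w y\<bar> \<le> C * \<bar>x - y\<bar> powr ?r" if "x \<in> {a..b}" "y \<in> {a..b}" for x y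
  proof -
    have "\<bar>flux p (?h x) - flux p (?h y)\<bar> \<le> (p - 1) * \<bar>?h x - ?h y\<bar>"
      by (intro flux_Lipschitz scaled_distance_bounds assms p that)
    also have "\<dots> \<le> (p - 1) * (c * \<bar>x - y\<bar>)"
      using p scaled_distance_diff_le[OF assms(1) p] by (intro mult_left_mono) (auto simp: c_def)
    finally have flux_le: "\<bar>flux p (?h x) - flux p (?h y)\<bar> \<le> (p - 1) * c * \<bar>x - y\<bar>"
      by (simp add: mult.assoc)
    have "\<bar>w x - w y\<bar> \<le> \<bar>flux p (?h x) - flux p (?h y)\<bar> powr ?r"
      unfolding w_def using assms by (intro powr_diff_le) (auto simp: flux_def)
    also have "\<dots> \<le> ((p - 1) * c * \<bar>x - y\<bar>) powr ?r"
      using p flux_le by (intro powr_mono2) auto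
    finally show ?thesis
      using c p by (simp add: C_def powr_mult)
  qed
  have "\<bar>eigenfun_deriv p a b x - eigenfun_deriv p a b y\<bar> \<le> 2 * c * C * \<bar>x - y\<bar> powr ?r"
    if x: "x \<in> {a..b}" and y: "y \<in> {a..b}" for x y
  proof -
    let ?H = "C * \<bar>x - y\<bar> powr ?r"
    have H: "0 \<le> ?H" by (simp add: C_def)
    have "\<bar>sgn (x - ?m) * w x - sgn (y - ?m) * w y\<bar> \<le> 2 * ?H"
    proof (cases "(x - ?m) * (y - ?m) > 0")
      case True
      then have "sgn (x - ?m) = sgn (y - ?m)" "\<bar>sgn (y - ?m)\<bar> = 1"
        by (auto simp: zero_less_mult_iff sgn_if)
      then have "\<bar>sgn (x - ?m) * w x - sgn (y - ?m) * w y\<bar> = \<bar>w x - w y\<bar>"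
        by (metis abs_mult mult_1 right_diff_distrib)
      then show ?thesis using w[OF x y] H by linarith
    next
      case False
      have m: "?m \<in> {a..b}" using assms by auto
      have le: "\<bar>x - ?m\<bar> \<le> \<bar>x - y\<bar>" "\<bar>y - ?m\<bar> \<le> \<bar>x - y\<bar>"
      proof -
        have "(x \<le> ?m \<and> ?m \<le> y) \<or> (y \<le> ?m \<and> ?m \<le> x)"
          using False by (simp only: zero_less_mult_iff) linarith
        then show "\<bar>x - ?m\<bar> \<le> \<bar>x - y\<bar>" "\<bar>y - ?m\<bar> \<le> \<bar>x - y\<bar>" by linarith+
      qed
      have "\<bar>sgn (z - ?m) * w z\<bar> \<le> ?H" if z: "z \<in> {a..b}" "\<bar>z - ?m\<bar> \<le> \<bar>x - y\<bar>" for z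
      proof -
        have "\<bar>sgn (z - ?m) * w z\<bar> \<le> \<bar>w z - w ?m\<bar>"
          using w0[of z] by (simp add: wm sgn_if)
        also have "\<dots> \<le> C * \<bar>z - ?m\<bar> powr ?r" by (rule w[OF z(1) m])
        also have "\<dots> \<le> ?H"
          using z(2) p by (intro mult_left_mono powr_mono2) (auto simp: C_def)
        finally show ?thesis .
      qed
      from this[OF x le(1)] this[OF y le(2)] show ?thesis by linarith
    qed
    then have "c * \<bar>sgn (x - ?m) * w x - sgn (y - ?m) * w y\<bar> \<le> c * (2 * ?H)"
      using c by (intro mult_left_mono) auto
    moreover have "\<bar>eigenfun_deriv p a b x - eigenfun_deriv p a b y\<bar>
        = c * \<bar>sgn (x - ?m) * w x - sgn (y - ?m) * w y\<bar>"
    proof -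
      have "eigenfun_deriv p a b x - eigenfun_deriv p a b y
        = - c * (sgn (x - ?m) * w x - sgn (y - ?m) * w y)"
        unfolding g by (simp add: algebra_simps)
      then show ?thesis using c by (simp add: abs_mult)
    qed
    ultimately show ?thesis by (simp add: mult.assoc mult.left_commute)
  qed
  then show ?thesis unfolding holder_on_def by blast
qed

lemma holder_on_imp_continuous_on:
  assumes "holder_on \<sigma> S g" "0 < \<sigma>"
  shows "continuous_on S g"
  unfolding continuous_on_def
proof
  fix x assume x: "x \<in> S"
  obtain C where C: "\<And>x y. x \<in> S \<Longrightarrow> y \<in> S \<Longrightarrow> \<bar>g x - g y\<bar> \<le> C * \<bar>x - y\<bar> powr \<sigma>"
    using assms unfolding holder_on_def by blast
  have "((\<lambda>y. C * \<bar>y - x\<bar> powr \<sigma>) \<longlongrightarrow> C * \<bar>x - x\<bar> powr \<sigma>) (at x within S)"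
    using assms(2) by (intro tendsto_intros) auto
  then have "((\<lambda>y. C * \<bar>y - x\<bar> powr \<sigma>) \<longlongrightarrow> 0) (at x within S)" by simp
  moreover have "\<forall>\<^sub>F y in at x within S. norm (g y - g x) \<le> C * \<bar>y - x\<bar> powr \<sigma>"
    using C x by (auto simp: eventually_at_filter)
  ultimately show "(g \<longlongrightarrow> g x) (at x within S)"
    using Lim_null_comparison LIM_zero_cancel by fast
qed

lemma eigenfun_DERIV:
  assumes "a < b" "1 < p" "x \<in> {a<..<b}"
  shows "(eigenfun p a b has_real_derivative eigenfun_deriv p a b x) (at x)"
proof -
  have "at x within {a..b} = at x"
    by (rule at_within_interior) (use assms in auto)
  then show ?thesis using eigenfun_has_derivative[of a b p x] assms by auto
qed

lemma eigenfun_deficit_tendsto: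
  assumes "a < b" "1 < p"
  shows "((\<lambda>x. (1 - eigenfun p a b x) / \<bar>x - (a + b) / 2\<bar> powr (p / (p - 1))) \<longlongrightarrow> K_const p a b)
    (at ((a + b) / 2))"
proof -
  let ?c = "gen_pi p / (b - a)" and ?h = "scaled_distance p a b" and ?q = "p / (p - 1)"
  have c: "?c > 0" using gen_pi_pos assms by simp
  have "((\<lambda>x. (1 - profile p (?h x)) / ?h x powr ?q * ?c powr ?q)
      \<longlongrightarrow> (p - 1) powr ?q / p * ?c powr ?q) (at ((a + b) / 2))"
    by (intro tendsto_mult tendsto_const
        filterlim_compose[OF profile_deficit_tendsto filterlim_scaled_distance] assms)
  moreover have "(1 - profile p (?h x)) / ?h x powr ?q * ?c powr ?q
      = (1 - eigenfun p a b x) / \<bar>x - (a + b) / 2\<bar> powr ?q" for x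
  proof -
    have "A / (k * d) * k = A / d" if "k \<noteq> 0" for A k d :: real
      using that by simp
    moreover have "?h x powr ?q = ?c powr ?q * \<bar>x - (a + b) / 2\<bar> powr ?q"
      unfolding scaled_distance_def by (rule powr_mult)
    moreover have "?c powr ?q \<noteq> 0" using c by (simp only: powr_eq_0_iff)
    ultimately show ?thesis
      unfolding eigenfun_eq_profile[OF assms] by presburger
  qed
  ultimately show ?thesis
    by (simp only: K_const_def)
qed

text \<open>With \<open>w = flux\<close> to the power \<open>1 / (p - 1)\<close>, the flux is \<open>w\<close> times \<open>w\<close> to the power
  \<open>p - 2\<close>. A second derivative at the midpoint would bound \<open>w(y) / y\<close>, and the other
  factor tends to \<open>0\<close> since \<open>p > 2\<close>; this contradicts the limit \<open>p - 1\<close> of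
  \<open>flux y / y\<close>.\<close>
lemma eigenfun_not_C2:
  assumes "a < b" "2 < p"
  shows "\<not> C2_on {a<..<b} (eigenfun p a b)"
proof
  let ?m = "(a + b) / 2" and ?h = "scaled_distance p a b"
  define c where "c = gen_pi p / (b - a)"
  have p: "1 < p" using assms by simp
  have c: "c > 0" using gen_pi_pos[OF p] assms by (simp add: c_def)
  have m: "?m \<in> {a<..<b}" using assms by auto
  assume "C2_on {a<..<b} (eigenfun p a b)"
  then obtain f' f'' where f': "\<And>x. x \<in> {a<..<b} \<Longrightarrow> (eigenfun p a b has_real_derivative f' x) (at x within {a<..<b})"
    and f'': "\<And>x. x \<in> {a<..<b} \<Longrightarrow> (f' has_real_derivative f'' x) (at x within {a<..<b})"
    unfolding C2_on_def by blast
  have "f' x = eigenfun_deriv p a b x" if "x \<in> {a<..<b}" for x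
    using f'[OF that] unfolding at_within_open[OF that open_greaterThanLessThan]
    by (rule DERIV_unique[OF _ eigenfun_DERIV[OF assms(1) p that]])
  then have f'_eq: "f' x = - c * sgn (x - ?m) * flux p (?h x) powr (1 / (p - 1))" if "x \<in> {a<..<b}" for x
    using that by (simp add: eigenfun_deriv_def c_def)
  have f'm: "f' ?m = 0" using f'_eq[OF m] by simp
  have lim: "filterlim ?h (at_right 0) (at_right ?m)"
    by (rule filterlim_mono[OF filterlim_scaled_distance[OF assms(1) p]]) (auto simp: at_le)
  have lim1: "((\<lambda>x. flux p (?h x) / ?h x) \<longlongrightarrow> p - 1) (at_right ?m)"
    by (rule filterlim_compose[OF flux_over_distance_tendsto[OF p] lim])
  have "(f' has_real_derivative f'' ?m) (at ?m)"
    using f''[OF m] m by (simp only: at_within_open[OF m open_greaterThanLessThan])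
  then have "((\<lambda>x. (f' x - f' ?m) / (x - ?m)) \<longlongrightarrow> f'' ?m) (at ?m)"
    by (simp only: has_field_derivative_iff)
  then have d: "((\<lambda>x. (f' x - f' ?m) / (x - ?m)) \<longlongrightarrow> f'' ?m) (at_right ?m)"
    by (rule tendsto_mono[rotated]) (auto simp: at_le)
  have "((\<lambda>x. flux p (?h x) powr ((p - 2) / (p - 1))) \<longlongrightarrow> 0) (at_right ?m)"
    by (rule tendsto_zero_powrI[OF filterlim_compose[OF flux_tendsto[OF p] lim] tendsto_const])
       (use assms in \<open>auto simp: flux_def\<close>)
  from tendsto_mult[OF tendsto_mult[OF d tendsto_const[of "- 1 / c^2"]] this]
  have "((\<lambda>x. (f' x - f' ?m) / (x - ?m) * (- 1 / c^2) * flux p (?h x) powr ((p - 2) / (p - 1))) \<longlongrightarrow> 0) (at_right ?m)"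
    by simp
  then have "((\<lambda>x. flux p (?h x) / ?h x) \<longlongrightarrow> 0) (at_right ?m)"
  proof (rule Lim_transform_eventually)
    have "\<forall>\<^sub>F x in at_right ?m. ?m < x \<and> x < b"
      unfolding eventually_at_right_field using m by (intro exI[of _ b]) auto
    then show "\<forall>\<^sub>F x in at_right ?m. (f' x - f' ?m) / (x - ?m) * (- 1 / c^2) * flux p (?h x) powr ((p - 2) / (p - 1))
      = flux p (?h x) / ?h x"
    proof eventually_elim
      case (elim x)
      let ?f = "flux p (?h x)"
      have x: "x \<in> {a<..<b}" using elim m by auto
      have h: "?h x = c * (x - ?m)" using elim by (simp add: scaled_distance_def c_def)
      have sg: "sgn (x - ?m) = 1" using elim by (simp only: sgn_pos diff_gt_0_iff_gt)
      have "1 / (p - 1) + (p - 2) / (p - 1) = 1"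
        using p by (simp add: field_simps)
      then have f: "?f powr (1 / (p - 1)) * ?f powr ((p - 2) / (p - 1)) = ?f"
        by (metis powr_add powr_one flux_def powr_ge_zero)
      \<comment> \<open>Naming the powers keeps the simplifier from recombining them, so that only rational
        arithmetic is left.\<close>
      define F1 F2 F d where "F1 = ?f powr (1 / (p - 1))" and "F2 = ?f powr ((p - 2) / (p - 1))"
        and "F = ?f" and "d = x - ?m"
      have "d > 0" using elim by (simp add: d_def)
      then have "(- c * 1 * F1 - 0) / d * (- 1 / c^2) * F2 = F / (c * d)"
        using f[folded F1_def F2_def F_def] c by (simp add: field_simps power2_eq_square)
      then show ?case
        unfolding f'm f'_eq[OF x] sg h[symmetric] F1_def F2_def F_def d_def by simp
    qed
  qed
  from tendsto_unique[OF _ this lim1] p show False by simp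
qed

theorem mainTheorem1:
  fixes a b p x\<^sub>0 :: real
  assumes "a < b" and "2 < p"
    and "x\<^sub>0 = (a + b) / 2"
  shows "(\<forall>x\<in>{a..b}. x \<noteq> x\<^sub>0 \<longrightarrow> eigenfun p a b x < eigenfun p a b x\<^sub>0) \<and>
    K_const p a b > 0 \<and>
    ((\<lambda>x. (1 - eigenfun p a b x) / \<bar>x - x\<^sub>0\<bar> powr (p / (p - 1))) \<longlongrightarrow> K_const p a b) (at x\<^sub>0) \<and>
    C1_holder_on (1 / (p - 1)) {a..b} (eigenfun p a b) \<and>
    holder_at (1 / (p - 1)) x\<^sub>0 (deriv (eigenfun p a b)) \<and>
    \<not> C2_on {a<..<b} (eigenfun p a b)"
proof (intro conjI)
  have p: "1 < p" using assms by simp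
  have x0: "x\<^sub>0 \<in> {a<..<b}" using assms by auto
  show "\<forall>x\<in>{a..b}. x \<noteq> x\<^sub>0 \<longrightarrow> eigenfun p a b x < eigenfun p a b x\<^sub>0"
  proof (intro ballI impI)
    fix x assume x: "x \<in> {a..b}" "x \<noteq> x\<^sub>0"
    have "profile p (scaled_distance p a b x) < 1"
      using profile_less_1[OF p] scaled_distance_pos[OF assms(1) p] scaled_distance_bounds[OF assms(1) p x(1)] x assms
      by auto
    moreover have "profile p (scaled_distance p a b x\<^sub>0) = 1"
      using p unfolding assms(3) by (simp add: scaled_distance_def)
    ultimately show "eigenfun p a b x < eigenfun p a b x\<^sub>0"
      by (simp add: eigenfun_eq_profile[OF assms(1) p])
  qed
  show "K_const p a b > 0"
    using gen_pi_pos[OF p] assms by (simp add: K_const_def)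
  show "((\<lambda>x. (1 - eigenfun p a b x) / \<bar>x - x\<^sub>0\<bar> powr (p / (p - 1))) \<longlongrightarrow> K_const p a b) (at x\<^sub>0)"
    unfolding assms(3) by (rule eigenfun_deficit_tendsto[OF assms(1) p])
  have holder: "holder_on (1 / (p - 1)) {a..b} (eigenfun_deriv p a b)"
    using assms by (intro eigenfun_deriv_holder) auto
  show "C1_holder_on (1 / (p - 1)) {a..b} (eigenfun p a b)"
    unfolding C1_holder_on_def
    using eigenfun_has_derivative[OF assms(1) p] holder_on_imp_continuous_on[OF holder] holder p
    by (intro exI[of _ "eigenfun_deriv p a b"]) auto
  have deriv_eq: "deriv (eigenfun p a b) x = eigenfun_deriv p a b x" if "x \<in> {a<..<b}" for x
    by (rule DERIV_imp_deriv[OF eigenfun_DERIV[OF assms(1) p that]])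
  obtain C where C: "\<And>x y. x \<in> {a..b} \<Longrightarrow> y \<in> {a..b} \<Longrightarrow>
      \<bar>eigenfun_deriv p a b x - eigenfun_deriv p a b y\<bar> \<le> C * \<bar>x - y\<bar> powr (1 / (p - 1))"
    using holder unfolding holder_on_def by blast
  have "\<forall>\<^sub>F x in nhds x\<^sub>0. x \<in> {a<..<b}"
    using x0 by (intro eventually_nhds_in_open) auto
  then show "holder_at (1 / (p - 1)) x\<^sub>0 (deriv (eigenfun p a b))"
    unfolding holder_at_def
    by (intro exI[of _ C]) (auto elim!: eventually_mono simp: deriv_eq deriv_eq[OF x0] intro!: C x0
        simp: less_imp_le x0[simplified])
  show "\<not> C2_on {a<..<b} (eigenfun p a b)"
    by (rule eigenfun_not_C2[OF assms(1,2)])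
qed

end
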